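(* Let $G$ be a topological group. Then $G$ is extremely amenable if and only if for any locally trivial transitive groupoid $\mathcal G=(G_0,G_1)$ with structural group $G$ and any action of $\mathcal G$ on a (nonempty) topological space $X$ with proper anchor map $\rho:X\to G_0$ there exists a continuous $\mathcal G$-invariant section $G_0\to X$ of $\rho$.
   Context: All topological spaces and groups are Hausdorff. A topological group $G$ is extremely amenable if every continuous action of $G$ on a (nonempty) compact Hausdorff space has a fixed point. A topological groupoid $\mathcal G=(G_0,G_1)$ is a groupoid with object space $G_0$ and arrow space $G_1$ topological spaces and continuous source $s$, target $t$, multiplication, unit $u:G_0\to G_1$ and inverse. Products are written so that $gh$ is defined when $t(g)=s(h)$, with $s(gh)=s(g)$, $t(gh)=t(h)$. $\mathcal G$ is transitive if for all $x,y\in G_0$ there is $g\in G_1$ with $s(g)=x$, $t(g)=y$. $\mathcal G$ is locally trivial if every $x\in G_0$ has an open neighbourhood $U$ and a continuous map $\tau:U\to G_1$ with $t\circ\tau=\mathrm{id}_U$ and $s\circ\tau$ constantly equal to $x$. The structural group is $G[x]=\{g\in G_1: s(g)=t(g)=x\}$, which up to isomorphism does not depend on $x\in G_0$ when $\mathcal G$ is transitive. A (right) action of $\mathcal G$ on $X$ with anchor map $\rho$ consists of continuous maps $\rho:X\to G_0$ and $X\times_{\rho,s}G_1=\{(z,g): s(g)=\rho(z)\}\to X$, $(z,g)\mapsto zg$, with $\rho(zg)=t(g)$, $(zh)g=z(hg)$, $z\,u(\rho(z))=z$. The anchor map is proper if preimages of compact sets are compact. A section $\sigma:G_0\to X$ of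 $\rho$ is $\mathcal G$-invariant if $\sigma(s(g))g=\sigma(t(g))$ for all $g\in G_1$. *)

theory Defs
  imports "HOL-Analysis.Analysis" "HOL-Algebra.Group_Action"
begin

text \<open>Groups and spaces are treated as objects: \<^verbatim>\<open>HOL-Algebra\<close> groups and abstract topologies
  with explicit carriers. All spaces are required to be Hausdorff.\<close>

section \<open>Topological groups and extreme amenability\<close>

locale topological_group = group G for G :: "('g, 'm) monoid_scheme" (structure) +
  fixes T :: "'g topology"
  assumes topspace_eq: "topspace T = carrier G"
    and Hausdorff: "Hausdorff_space T"
    and continuous_mult: "continuous_map (prod_topology T T) T (\<lambda>(g, h). g \<otimes> h)"
    and continuous_inv: "continuous_map T T (\<lambda>g. inv g)"

definition topological_group_iso ::
    "('g, 'm) monoid_scheme \<Rightarrow> 'g topology \<Rightarrow> ('h, 'n) monoid_scheme \<Rightarrow> 'h topology \<Rightarrow> bool"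
  where "topological_group_iso G T H S \<longleftrightarrow> (\<exists>f. f \<in> iso G H \<and> homeomorphic_map T S f)"

definition continuous_action ::
    "('g, 'm) monoid_scheme \<Rightarrow> 'g topology \<Rightarrow> 'x topology \<Rightarrow> ('g \<Rightarrow> 'x \<Rightarrow> 'x) \<Rightarrow> bool"
  where "continuous_action G T X \<phi> \<longleftrightarrow>
    group_action G (topspace X) \<phi> \<and>
    continuous_map (prod_topology T X) X (\<lambda>(g, x). \<phi> g x)"

text \<open>HOL cannot quantify over types inside a formula, so the compact spaces below have their
  points in the fixed type \<^typ>\<open>'g set set\<close>. This loses nothing: the closure of an orbit has at
  most as many points as there are sets of subsets of the group, hence the definition yields fixed
  points on compact Hausdorff spaces over an arbitrary type (lemma
  \<^verbatim>\<open>extremely_amenable_fixed_point\<close>).\<close>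

definition extremely_amenable :: "('g, 'm) monoid_scheme \<Rightarrow> 'g topology \<Rightarrow> bool"
  where "extremely_amenable G T \<longleftrightarrow>
    (\<forall>(X :: 'g set set topology) \<phi>.
       compact_space X \<and> Hausdorff_space X \<and> topspace X \<noteq> {} \<and> continuous_action G T X \<phi>
       \<longrightarrow> (\<exists>x\<in>topspace X. \<forall>g\<in>carrier G. \<phi> g x = x))"

lemma group_actionI:
  assumes "group G"
    and ext: "\<And>g. g \<in> carrier G \<Longrightarrow> \<phi> g \<in> extensional E"
    and cl: "\<And>g x. g \<in> carrier G \<Longrightarrow> x \<in> E \<Longrightarrow> \<phi> g x \<in> E"
    and one: "\<And>x. x \<in> E \<Longrightarrow> \<phi> \<one>\<^bsub>G\<^esub> x = x"
    and mult: "\<And>g h x. g \<in> carrier G \<Longrightarrow> h \<in> carrier G \<Longrightarrow> x \<in> E \<Longrightarrow>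
      \<phi> (g \<otimes>\<^bsub>G\<^esub> h) x = \<phi> g (\<phi> h x)"
  shows "group_action G E \<phi>"
proof -
  interpret group G by fact
  have bij: "\<phi> g \<in> Bij E" if g: "g \<in> carrier G" for g
  proof -
    have "bij_betw (\<phi> g) E E"
    proof (rule bij_betwI[where g = "\<phi> (inv\<^bsub>G\<^esub> g)"])
      show "\<phi> (inv\<^bsub>G\<^esub> g) (\<phi> g x) = x" if "x \<in> E" for x
        using mult[of "inv\<^bsub>G\<^esub> g" g x] g that one by simp
      show "\<phi> g (\<phi> (inv\<^bsub>G\<^esub> g) x) = x" if "x \<in> E" for x
        using mult[of g "inv\<^bsub>G\<^esub> g" x] g that one by simp
    qed (use cl g in auto)
    then show ?thesis using ext g by (simp add: Bij_def)
  qed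
  have "\<phi> (g \<otimes>\<^bsub>G\<^esub> h) = compose E (\<phi> g) (\<phi> h)" if "g \<in> carrier G" "h \<in> carrier G" for g h
  proof (rule extensionalityI[where A = E])
    show "\<phi> (g \<otimes>\<^bsub>G\<^esub> h) \<in> extensional E" using ext that by simp
  qed (use mult that in \<open>auto simp: compose_def\<close>)
  then have "\<phi> \<in> hom G (BijGroup E)"
    using bij by (auto simp: hom_def BijGroup_def)
  then show ?thesis
    by (simp add: group_action_def group_hom_def group_hom_axioms_def group_BijGroup is_group)
qed

lemma extremely_amenable_fixed_point:
  fixes G :: "('g, 'm) monoid_scheme" and T :: "'g topology" and X :: "'x topology"
  assumes "topological_group G T" and ea: "extremely_amenable G T"
    and X: "compact_space X" "Hausdorff_space X" "topspace X \<noteq> {}"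
    and act: "continuous_action G T X \<phi>"
  shows "\<exists>x\<in>topspace X. \<forall>g\<in>carrier G. \<phi> g x = x"
proof -
  interpret topological_group G T by fact
  interpret A: group_action G "topspace X" \<phi>
    using act by (simp add: continuous_action_def)
  have cont: "continuous_map (prod_topology T X) X (\<lambda>(g, x). \<phi> g x)"
    using act by (simp add: continuous_action_def)
  have cl: "\<phi> g x \<in> topspace X" if "g \<in> carrier G" "x \<in> topspace X" for g x
    using that A.element_image by blast
  have mult: "\<phi> (g \<otimes>\<^bsub>G\<^esub> h) x = \<phi> g (\<phi> h x)"
    if "g \<in> carrier G" "h \<in> carrier G" "x \<in> topspace X" for g h x
    using A.composition_rule that by simp
  have one: "\<phi> \<one>\<^bsub>G\<^esub> x = x" if "x \<in> topspace X" for x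
    using A.id_eq_one that by (metis restrict_apply')
  obtain x0 where x0: "x0 \<in> topspace X" using X by blast
  define Orb where "Orb = (\<lambda>g. \<phi> g x0) ` carrier G"
  define Y where "Y = X closure_of Orb"
  have OX: "Orb \<subseteq> topspace X" using cl x0 by (auto simp: Orb_def)
  have YX: "Y \<subseteq> topspace X" by (simp add: Y_def closure_of_subset_topspace)
  have OY: "Orb \<subseteq> Y" using closure_of_subset[OF OX] by (simp add: Y_def)
  have contg: "continuous_map X X (\<phi> g)" if "g \<in> carrier G" for g
  proof -
    have "continuous_map X (prod_topology T X) (\<lambda>x. (g, x))"
      using that by (simp add: continuous_map_pairwise o_def topspace_eq)
    from continuous_map_compose[OF this cont] show ?thesis by (simp add: o_def)
  qed
  have clY: "\<phi> g y \<in> Y" if g: "g \<in> carrier G" and y: "y \<in> Y" for g y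
  proof -
    have "\<phi> g ` Orb \<subseteq> Orb"
      using mult[symmetric] g x0 by (auto simp: Orb_def)
    moreover have "\<phi> g ` (X closure_of Orb) \<subseteq> X closure_of (\<phi> g ` Orb)"
      using contg[OF g] continuous_map_image_closure_subset by blast
    ultimately show ?thesis
      using closure_of_mono[of "\<phi> g ` Orb" Orb X] y by (auto simp: Y_def)
  qed
  define j :: "'x \<Rightarrow> 'g set set"
    where "j x = {A. A \<subseteq> carrier G \<and> x \<in> X closure_of ((\<lambda>g. \<phi> g x0) ` A)}" for x
  have "inj_on j Y"
  proof (rule inj_onI, rule ccontr)
    fix x y assume xy: "x \<in> Y" "y \<in> Y" "j x = j y" "x \<noteq> y"
    then obtain U V where UV: "openin X U" "openin X V" "x \<in> U" "y \<in> V" "disjnt U V"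
      using X(2) YX unfolding Hausdorff_space_def by (meson subsetD)
    define A where "A = {g \<in> carrier G. \<phi> g x0 \<in> U}"
    have im: "(\<lambda>g. \<phi> g x0) ` A = U \<inter> Orb" by (auto simp: A_def Orb_def)
    have "x \<in> X closure_of (U \<inter> Orb)"
      using openin_Int_closure_of_subset[OF UV(1), of Orb] xy UV by (auto simp: Y_def)
    then have "A \<in> j x" by (auto simp: j_def im) (auto simp: A_def)
    then have "A \<in> j y" using xy by simp
    then have "y \<in> X closure_of (U \<inter> Orb)" by (simp add: j_def im)
    then show False using UV by (auto simp: in_closure_of disjnt_def)
  qed
  define k where "k = inv_into Y j"
  have kj: "k (j y) = y" if "y \<in> Y" for y
    using \<open>inj_on j Y\<close> that by (simp add: k_def)
  define Z where "Z = pullback_topology (j ` Y) k X"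
  have topZ: "topspace Z = j ` Y"
    using kj YX by (auto simp: Z_def topspace_pullback_topology)
  have contk: "continuous_map Z (subtopology X Y) k"
    using continuous_map_pullback[OF continuous_map_id, of "j ` Y" k X] kj topZ
    by (auto simp: continuous_map_in_subtopology Z_def)
  have contj: "continuous_map (subtopology X Y) Z j"
    unfolding Z_def
  proof (rule continuous_map_pullback')
    show "continuous_map (subtopology X Y) X (k \<circ> j)"
      by (rule continuous_map_eq[of _ _ id]) (use kj in \<open>auto simp: continuous_map_from_subtopology\<close>)
  qed auto
  have hom: "subtopology X Y homeomorphic_space Z"
    unfolding homeomorphic_space_def homeomorphic_maps_def
    using contj contk kj topZ by (intro exI[of _ j] exI[of _ k]) auto
  have "compactin X Y" using closedin_compact_space[OF X(1)] by (simp add: Y_def)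
  then have "compact_space Z"
    using homeomorphic_compact_space[OF hom] compact_space_subtopology by blast
  moreover have "Hausdorff_space Z"
    using homeomorphic_Hausdorff_space[OF hom] Hausdorff_space_subtopology[OF X(2)] by blast
  moreover have "topspace Z \<noteq> {}"
    using OY topZ by (auto simp: Orb_def)
  moreover define \<psi> where "\<psi> g = restrict (\<lambda>z. j (\<phi> g (k z))) (topspace Z)" for g
  have "continuous_action G T Z \<psi>"
    unfolding continuous_action_def
  proof
    show "group_action G (topspace Z) \<psi>"
      by (rule group_actionI)
        (use kj clY one mult YX in \<open>auto simp: \<psi>_def topZ is_group subset_iff\<close>)
    have "continuous_map (prod_topology T Z) (prod_topology T X) (\<lambda>(g, z). (g, k z))"
      using contk continuous_map_prod_top[of T Z T X id k]
      by (auto simp: continuous_map_in_subtopology id_def)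
    from continuous_map_compose[OF this cont]
    have "continuous_map (prod_topology T Z) X (\<lambda>(g, z). \<phi> g (k z))"
      by (simp add: o_def case_prod_unfold)
    then have "continuous_map (prod_topology T Z) (subtopology X Y) (\<lambda>(g, z). \<phi> g (k z))"
      using clY kj by (auto simp: continuous_map_in_subtopology topZ topspace_eq)
    from continuous_map_compose[OF this contj]
    have "continuous_map (prod_topology T Z) Z (\<lambda>(g, z). j (\<phi> g (k z)))"
      by (simp add: o_def case_prod_unfold)
    then show "continuous_map (prod_topology T Z) Z (\<lambda>(g, z). \<psi> g z)"
      by (rule continuous_map_eq) (auto simp: \<psi>_def)
  qed
  ultimately obtain z where z: "z \<in> topspace Z" "\<forall>g\<in>carrier G. \<psi> g z = z"
    using ea unfolding extremely_amenable_def by blast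
  then obtain y where y: "y \<in> Y" "z = j y" by (auto simp: topZ)
  have "\<phi> g y = y" if "g \<in> carrier G" for g
    using z(2) that y kj clY topZ unfolding \<psi>_def
    by (metis image_eqI restrict_apply')
  then show ?thesis using y YX by blast
qed


section \<open>Topological groupoids\<close>

record ('o, 'a) groupoid =
  objects :: "'o topology"
  arrows :: "'a topology"
  source :: "'a \<Rightarrow> 'o"
  target :: "'a \<Rightarrow> 'o"
  comp :: "'a \<Rightarrow> 'a \<Rightarrow> 'a"
  unit :: "'o \<Rightarrow> 'a"
  inverse_arrow :: "'a \<Rightarrow> 'a"

text \<open>Composition is in diagrammatic order: \<^term>\<open>comp \<Gamma> g h\<close> is meaningful only for arrows with
  \<^prop>\<open>target \<Gamma> g = source \<Gamma> h\<close>.\<close>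

definition composable :: "('o, 'a) groupoid \<Rightarrow> ('a \<times> 'a) set"
  where "composable \<Gamma> =
    {(g, h). g \<in> topspace (arrows \<Gamma>) \<and> h \<in> topspace (arrows \<Gamma>) \<and> target \<Gamma> g = source \<Gamma> h}"

locale topological_groupoid =
  fixes \<Gamma> :: "('o, 'a) groupoid"
  assumes Hausdorff_objects: "Hausdorff_space (objects \<Gamma>)"
    and Hausdorff_arrows: "Hausdorff_space (arrows \<Gamma>)"
    and continuous_source: "continuous_map (arrows \<Gamma>) (objects \<Gamma>) (source \<Gamma>)"
    and continuous_target: "continuous_map (arrows \<Gamma>) (objects \<Gamma>) (target \<Gamma>)"
    and continuous_comp:
      "continuous_map (subtopology (prod_topology (arrows \<Gamma>) (arrows \<Gamma>)) (composable \<Gamma>))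
         (arrows \<Gamma>) (\<lambda>(g, h). comp \<Gamma> g h)"
    and continuous_unit: "continuous_map (objects \<Gamma>) (arrows \<Gamma>) (unit \<Gamma>)"
    and continuous_inverse: "continuous_map (arrows \<Gamma>) (arrows \<Gamma>) (inverse_arrow \<Gamma>)"
    and source_comp: "(g, h) \<in> composable \<Gamma> \<Longrightarrow> source \<Gamma> (comp \<Gamma> g h) = source \<Gamma> g"
    and target_comp: "(g, h) \<in> composable \<Gamma> \<Longrightarrow> target \<Gamma> (comp \<Gamma> g h) = target \<Gamma> h"
    and comp_assoc: "(g, h) \<in> composable \<Gamma> \<Longrightarrow> (h, k) \<in> composable \<Gamma> \<Longrightarrow>
      comp \<Gamma> (comp \<Gamma> g h) k = comp \<Gamma> g (comp \<Gamma> h k)"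
    and source_unit: "x \<in> topspace (objects \<Gamma>) \<Longrightarrow> source \<Gamma> (unit \<Gamma> x) = x"
    and target_unit: "x \<in> topspace (objects \<Gamma>) \<Longrightarrow> target \<Gamma> (unit \<Gamma> x) = x"
    and unit_left: "g \<in> topspace (arrows \<Gamma>) \<Longrightarrow> comp \<Gamma> (unit \<Gamma> (source \<Gamma> g)) g = g"
    and unit_right: "g \<in> topspace (arrows \<Gamma>) \<Longrightarrow> comp \<Gamma> g (unit \<Gamma> (target \<Gamma> g)) = g"
    and source_inverse:
      "g \<in> topspace (arrows \<Gamma>) \<Longrightarrow> source \<Gamma> (inverse_arrow \<Gamma> g) = target \<Gamma> g"
    and target_inverse:
      "g \<in> topspace (arrows \<Gamma>) \<Longrightarrow> target \<Gamma> (inverse_arrow \<Gamma> g) = source \<Gamma> g"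
    and inverse_right:
      "g \<in> topspace (arrows \<Gamma>) \<Longrightarrow> comp \<Gamma> g (inverse_arrow \<Gamma> g) = unit \<Gamma> (source \<Gamma> g)"
    and inverse_left:
      "g \<in> topspace (arrows \<Gamma>) \<Longrightarrow> comp \<Gamma> (inverse_arrow \<Gamma> g) g = unit \<Gamma> (target \<Gamma> g)"

definition transitive_groupoid :: "('o, 'a) groupoid \<Rightarrow> bool"
  where "transitive_groupoid \<Gamma> \<longleftrightarrow>
    (\<forall>x\<in>topspace (objects \<Gamma>). \<forall>y\<in>topspace (objects \<Gamma>).
       \<exists>g\<in>topspace (arrows \<Gamma>). source \<Gamma> g = x \<and> target \<Gamma> g = y)"

definition locally_trivial_groupoid :: "('o, 'a) groupoid \<Rightarrow> bool"
  where "locally_trivial_groupoid \<Gamma> \<longleftrightarrow>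
    (\<forall>x\<in>topspace (objects \<Gamma>). \<exists>U \<tau>. openin (objects \<Gamma>) U \<and> x \<in> U \<and>
       continuous_map (subtopology (objects \<Gamma>) U) (arrows \<Gamma>) \<tau> \<and>
       (\<forall>y\<in>U. target \<Gamma> (\<tau> y) = y \<and> source \<Gamma> (\<tau> y) = x))"

definition vertex_group :: "('o, 'a) groupoid \<Rightarrow> 'o \<Rightarrow> 'a monoid"
  where "vertex_group \<Gamma> x =
    \<lparr>carrier = {g \<in> topspace (arrows \<Gamma>). source \<Gamma> g = x \<and> target \<Gamma> g = x},
     mult = comp \<Gamma>, one = unit \<Gamma> x\<rparr>"

definition vertex_topology :: "('o, 'a) groupoid \<Rightarrow> 'o \<Rightarrow> 'a topology"
  where "vertex_topology \<Gamma> x = subtopology (arrows \<Gamma>) (carrier (vertex_group \<Gamma> x))"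

text \<open>For a transitive groupoid all vertex groups are isomorphic as topological groups (by
  conjugation), so it does not matter at which object the isomorphism is required.\<close>

definition has_structural_group ::
    "('o, 'a) groupoid \<Rightarrow> ('g, 'm) monoid_scheme \<Rightarrow> 'g topology \<Rightarrow> bool"
  where "has_structural_group \<Gamma> G T \<longleftrightarrow>
    (\<exists>x\<in>topspace (objects \<Gamma>).
       topological_group_iso G T (vertex_group \<Gamma> x) (vertex_topology \<Gamma> x))"


section \<open>Actions of topological groupoids\<close>

definition actable :: "('o, 'a) groupoid \<Rightarrow> 'x topology \<Rightarrow> ('x \<Rightarrow> 'o) \<Rightarrow> ('x \<times> 'a) set"
  where "actable \<Gamma> X \<rho> =
    {(z, g). z \<in> topspace X \<and> g \<in> topspace (arrows \<Gamma>) \<and> source \<Gamma> g = \<rho> z}"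

locale groupoid_action =
  fixes \<Gamma> :: "('o, 'a) groupoid" and X :: "'x topology"
    and \<rho> :: "'x \<Rightarrow> 'o" and act :: "'x \<Rightarrow> 'a \<Rightarrow> 'x"
  assumes continuous_anchor: "continuous_map X (objects \<Gamma>) \<rho>"
    and continuous_act:
      "continuous_map (subtopology (prod_topology X (arrows \<Gamma>)) (actable \<Gamma> X \<rho>)) X
         (\<lambda>(z, g). act z g)"
    and anchor_act: "(z, g) \<in> actable \<Gamma> X \<rho> \<Longrightarrow> \<rho> (act z g) = target \<Gamma> g"
    and act_comp: "(z, h) \<in> actable \<Gamma> X \<rho> \<Longrightarrow> (h, g) \<in> composable \<Gamma> \<Longrightarrow>
      act (act z h) g = act z (comp \<Gamma> h g)"
    and act_unit: "z \<in> topspace X \<Longrightarrow> act z (unit \<Gamma> (\<rho> z)) = z"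

text \<open>Properness in the sense that preimages of compact sets are compact; the library's
  \<^const>\<open>proper_map\<close> (closed with compact fibres) is a different notion in general.\<close>

definition proper_anchor :: "('o, 'a) groupoid \<Rightarrow> 'x topology \<Rightarrow> ('x \<Rightarrow> 'o) \<Rightarrow> bool"
  where "proper_anchor \<Gamma> X \<rho> \<longleftrightarrow>
    (\<forall>K. compactin (objects \<Gamma>) K \<longrightarrow> compactin X {z \<in> topspace X. \<rho> z \<in> K})"

definition continuous_invariant_section ::
    "('o, 'a) groupoid \<Rightarrow> 'x topology \<Rightarrow> ('x \<Rightarrow> 'o) \<Rightarrow> ('x \<Rightarrow> 'a \<Rightarrow> 'x) \<Rightarrow> ('o \<Rightarrow> 'x) \<Rightarrow> bool"
  where "continuous_invariant_section \<Gamma> X \<rho> act \<sigma> \<longleftrightarrow>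
    continuous_map (objects \<Gamma>) X \<sigma> \<and>
    (\<forall>x\<in>topspace (objects \<Gamma>). \<rho> (\<sigma> x) = x) \<and>
    (\<forall>g\<in>topspace (arrows \<Gamma>). act (\<sigma> (source \<Gamma> g)) g = \<sigma> (target \<Gamma> g))"

text \<open>When groupoids with arrows in \<^typ>\<open>'g + 'a\<close> and spaces with points in
  \<^typ>\<open>'g set set + 'x\<close> are quantified over, the type variables \<^typ>\<open>'a\<close> and \<^typ>\<open>'x\<close> are
  arbitrary, so (via \<^const>\<open>Inr\<close>) every groupoid and every space occurs up to isomorphism. The
  left summands only guarantee that the types are large enough to contain the group itself and
  the spaces on which extreme amenability is tested.\<close>

end

theory Submission
  imports Defs
begin

text \<open>If \<open>G\<close> is extremely amenable, it acts on the fibre of the anchor map over a base object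
  \<open>x\<^sub>0\<close>, which is compact by properness, and so fixes some \<open>\<xi>\<close> in it. The point \<open>\<xi> g\<close> then depends
  only on \<open>t(g)\<close> for \<open>g\<close> starting at \<open>x\<^sub>0\<close>, and sending \<open>t(g)\<close> to \<open>\<xi> g\<close> is the section; a local
  trivialisation \<open>\<tau>\<close> around \<open>y\<close> writes it as \<open>\<sigma> u = \<sigma> y (\<tau> u)\<close>, which is continuous.
  Conversely, \<open>G\<close> is a groupoid with one object, every space over a point is anchored, and an
  invariant section is a fixed point.\<close>

section \<open>Typing facts for arrows and actions\<close>

context topological_groupoid
begin

lemma source_in: "g \<in> topspace (arrows \<Gamma>) \<Longrightarrow> source \<Gamma> g \<in> topspace (objects \<Gamma>)"
  using continuous_map_image_subset_topspace[OF continuous_source] by blast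

lemma target_in: "g \<in> topspace (arrows \<Gamma>) \<Longrightarrow> target \<Gamma> g \<in> topspace (objects \<Gamma>)"
  using continuous_map_image_subset_topspace[OF continuous_target] by blast

lemma inverse_in: "g \<in> topspace (arrows \<Gamma>) \<Longrightarrow> inverse_arrow \<Gamma> g \<in> topspace (arrows \<Gamma>)"
  using continuous_map_image_subset_topspace[OF continuous_inverse] by blast

lemma comp_in:
  assumes "(g, h) \<in> composable \<Gamma>"
  shows "comp \<Gamma> g h \<in> topspace (arrows \<Gamma>)"
proof -
  have "(g, h) \<in> topspace (subtopology (prod_topology (arrows \<Gamma>) (arrows \<Gamma>)) (composable \<Gamma>))"
    using assms by (auto simp: composable_def)
  then show ?thesis
    using continuous_map_image_subset_topspace[OF continuous_comp] by blast
qed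

end

lemma (in groupoid_action) act_in:
  assumes "(z, g) \<in> actable \<Gamma> X \<rho>"
  shows "act z g \<in> topspace X"
proof -
  have "(z, g) \<in> topspace (subtopology (prod_topology X (arrows \<Gamma>)) (actable \<Gamma> X \<rho>))"
    using assms by (auto simp: actable_def)
  then show ?thesis
    using continuous_map_image_subset_topspace[OF continuous_act] by blast
qed

section \<open>From a fixed point over one object to an invariant section\<close>

text \<open>Moving \<open>\<xi>\<close> along the arrows that start at \<open>\<rho> \<xi>\<close>
  defines the section. Two such arrows with the same target differ by a loop at
  \<open>\<rho> \<xi>\<close>, and loops there fix \<open>\<xi>\<close>; transitivity reaches every
  object, and local triviality gives continuity.\<close>

lemma invariant_section_of_fixed_point:
  assumes "topological_groupoid \<Gamma>" "groupoid_action \<Gamma> X \<rho> act"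
    and lt: "locally_trivial_groupoid \<Gamma>" and tr: "transitive_groupoid \<Gamma>"
    and \<xi>: "\<xi> \<in> topspace X"
    and fixed: "\<And>h. h \<in> topspace (arrows \<Gamma>) \<Longrightarrow> source \<Gamma> h = \<rho> \<xi> \<Longrightarrow> target \<Gamma> h = \<rho> \<xi> \<Longrightarrow>
      act \<xi> h = \<xi>"
  shows "\<exists>\<sigma>. continuous_invariant_section \<Gamma> X \<rho> act \<sigma>"
proof -
  interpret topological_groupoid \<Gamma> by fact
  interpret groupoid_action \<Gamma> X \<rho> act by fact
  have \<rho>\<xi>: "\<rho> \<xi> \<in> topspace (objects \<Gamma>)"
    using continuous_map_image_subset_topspace[OF continuous_anchor] \<xi> by blast
  define from_base where
    "from_base g y \<longleftrightarrow> g \<in> topspace (arrows \<Gamma>) \<and> source \<Gamma> g = \<rho> \<xi> \<and> target \<Gamma> g = y" for g y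
  have same: "act \<xi> g = act \<xi> h" if "from_base g y" "from_base h y" for g h y
  proof -
    \<comment> \<open>The loop \<open>?k\<close> satisfies \<open>?k h = g\<close>, so moving
      \<open>\<xi>\<close> along \<open>g\<close> means applying \<open>?k\<close>, which fixes it,
      and then \<open>h\<close>.\<close>
    let ?k = "comp \<Gamma> g (inverse_arrow \<Gamma> h)"
    have gh: "(g, inverse_arrow \<Gamma> h) \<in> composable \<Gamma>" "(inverse_arrow \<Gamma> h, h) \<in> composable \<Gamma>"
      using that by (auto simp: composable_def from_base_def inverse_in source_inverse target_inverse)
    have k: "from_base ?k (\<rho> \<xi>)"
      using that gh by (simp add: from_base_def comp_in source_comp target_comp target_inverse)
    have "comp \<Gamma> ?k h = g"
      using comp_assoc[OF gh] that unit_right[of g] by (simp add: from_base_def inverse_left)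
    moreover have "act (act \<xi> ?k) h = act \<xi> (comp \<Gamma> ?k h)"
      using k that \<xi> by (intro act_comp) (auto simp: actable_def composable_def from_base_def)
    ultimately show ?thesis using fixed k by (simp add: from_base_def)
  qed
  \<comment> \<open>By \<open>same\<close> the value does not depend on the arrow chosen. Outside
    the object space it is arbitrary and never inspected.\<close>
  define \<sigma> where "\<sigma> y = act \<xi> (SOME g. from_base g y)" for y
  have \<sigma>: "\<sigma> y = act \<xi> g" if "from_base g y" for g y
    unfolding \<sigma>_def using same someI[of "\<lambda>g. from_base g y", OF that] that by blast
  have ex: "\<exists>g. from_base g y" if "y \<in> topspace (objects \<Gamma>)" for y
    using tr \<rho>\<xi> that unfolding transitive_groupoid_def from_base_def by metis
  have actable: "(\<xi>, g) \<in> actable \<Gamma> X \<rho>" if "from_base g y" for g y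
    using that \<xi> by (simp add: actable_def from_base_def)
  have anchor: "\<rho> (\<sigma> y) = y" and \<sigma>_in: "\<sigma> y \<in> topspace X" if "y \<in> topspace (objects \<Gamma>)" for y
  proof -
    obtain g where g: "from_base g y" using ex \<open>y \<in> _\<close> by blast
    show "\<rho> (\<sigma> y) = y" "\<sigma> y \<in> topspace X"
      using anchor_act[OF actable[OF g]] act_in[OF actable[OF g]] g
      by (simp_all add: \<sigma>[OF g] from_base_def)
  qed
  have invariant: "act (\<sigma> (source \<Gamma> g)) g = \<sigma> (target \<Gamma> g)" if g: "g \<in> topspace (arrows \<Gamma>)" for g
  proof -
    obtain h where h: "from_base h (source \<Gamma> g)" using ex source_in[OF g] by blast
    have hg: "(h, g) \<in> composable \<Gamma>" using h g by (simp add: composable_def from_base_def)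
    then have "from_base (comp \<Gamma> h g) (target \<Gamma> g)"
      using h by (simp add: from_base_def comp_in source_comp target_comp)
    then show ?thesis
      using act_comp[OF actable[OF h] hg] by (simp add: \<sigma>[OF h] \<sigma>)
  qed
  have local_cont: "\<exists>U. openin (objects \<Gamma>) U \<and> y \<in> U \<and> continuous_map (subtopology (objects \<Gamma>) U) X \<sigma>"
    if y: "y \<in> topspace (objects \<Gamma>)" for y
  proof -
    obtain U \<tau> where U: "openin (objects \<Gamma>) U" "y \<in> U"
      and \<tau>: "continuous_map (subtopology (objects \<Gamma>) U) (arrows \<Gamma>) \<tau>"
      and st: "\<And>u. u \<in> U \<Longrightarrow> target \<Gamma> (\<tau> u) = u" "\<And>u. u \<in> U \<Longrightarrow> source \<Gamma> (\<tau> u) = y"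
      using lt y unfolding locally_trivial_groupoid_def by metis
    have sub: "topspace (subtopology (objects \<Gamma>) U) = U"
      using openin_subset[OF U(1)] by auto
    have \<tau>_in: "\<tau> u \<in> topspace (arrows \<Gamma>)" if "u \<in> U" for u
      using continuous_map_image_subset_topspace[OF \<tau>] that sub by blast
    \<comment> \<open>The arrows \<open>\<tau> u\<close> start at \<open>y\<close>, not at the base
      object, so the point to be moved is \<open>\<sigma> y\<close> instead of \<open>\<xi>\<close>.
      It stays constant while \<open>u\<close> varies, and invariance along \<open>\<tau> u\<close>
      then identifies the result with \<open>\<sigma> u\<close>.\<close>
    have "continuous_map (subtopology (objects \<Gamma>) U)
        (subtopology (prod_topology X (arrows \<Gamma>)) (actable \<Gamma> X \<rho>)) (\<lambda>u. (\<sigma> y, \<tau> u))"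
      using \<tau> \<sigma>_in[OF y] anchor[OF y] \<tau>_in st sub
      by (auto simp: continuous_map_in_subtopology continuous_map_pairwise o_def actable_def)
    from continuous_map_compose[OF this continuous_act]
    have "continuous_map (subtopology (objects \<Gamma>) U) X (\<lambda>u. act (\<sigma> y) (\<tau> u))"
      by (simp add: o_def)
    then have "continuous_map (subtopology (objects \<Gamma>) U) X \<sigma>"
    proof (rule continuous_map_eq)
      fix u assume "u \<in> topspace (subtopology (objects \<Gamma>) U)"
      then show "act (\<sigma> y) (\<tau> u) = \<sigma> u" using invariant[OF \<tau>_in, of u] st sub by simp
    qed
    then show ?thesis using U by blast
  qed
  have "continuous_map (objects \<Gamma>) X \<sigma>"
  proof -
    obtain U where U: "\<And>y. y \<in> topspace (objects \<Gamma>) \<Longrightarrow>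
        openin (objects \<Gamma>) (U y) \<and> y \<in> U y \<and> continuous_map (subtopology (objects \<Gamma>) (U y)) X \<sigma>"
      using local_cont by metis
    show ?thesis
      \<comment> \<open>One neighbourhood per object gives an open cover; every local map is
        \<open>\<sigma>\<close> itself, so agreement on overlaps is automatic.\<close>
      by (rule pasting_lemma[where I = "topspace (objects \<Gamma>)" and T = U and f = "\<lambda>_. \<sigma>"])
        (use U in auto)
  qed
  then show ?thesis
    using anchor invariant unfolding continuous_invariant_section_def by blast
qed

section \<open>A fixed point in a compact fibre\<close>

text \<open>Loops at \<open>x\<close> map the fibre over \<open>x\<close> to itself, so
  \<open>G\<close> acts on this compact Hausdorff space through its isomorphism with the vertex
  group. As the points of the fibre may have any type, the fixed point comes from
  \<open>extremely_amenable_fixed_point\<close> and not directly from the definition.\<close>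

lemma fibre_fixed_point:
  assumes TG: "topological_group G T" and ea: "extremely_amenable G T"
    and "topological_groupoid \<Gamma>" "groupoid_action \<Gamma> X \<rho> act"
    and iso: "topological_group_iso G T (vertex_group \<Gamma> x) (vertex_topology \<Gamma> x)"
    and X: "Hausdorff_space X" and compact: "compactin X {z \<in> topspace X. \<rho> z = x}"
    and nonempty: "\<exists>z\<in>topspace X. \<rho> z = x"
  shows "\<exists>\<xi>\<in>topspace X. \<rho> \<xi> = x \<and>
    (\<forall>h\<in>topspace (arrows \<Gamma>). source \<Gamma> h = x \<longrightarrow> target \<Gamma> h = x \<longrightarrow> act \<xi> h = \<xi>)"
proof -
  interpret topological_group G T by fact
  interpret topological_groupoid \<Gamma> by fact
  interpret groupoid_action \<Gamma> X \<rho> act by fact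
  let ?H = "vertex_group \<Gamma> x"
  obtain f where f: "f \<in> iso G ?H" and fh: "homeomorphic_map T (vertex_topology \<Gamma> x) f"
    using iso unfolding topological_group_iso_def by blast
  have carr: "carrier ?H = {g \<in> topspace (arrows \<Gamma>). source \<Gamma> g = x \<and> target \<Gamma> g = x}"
    by (simp add: vertex_group_def)
  have bij: "f ` carrier G = carrier ?H"
    using f by (simp add: iso_def bij_betw_def)
  have f_in: "f g \<in> topspace (arrows \<Gamma>)" "source \<Gamma> (f g) = x" "target \<Gamma> (f g) = x"
    if "g \<in> carrier G" for g
    using bij carr that by auto
  have f_mult: "f (g \<otimes>\<^bsub>G\<^esub> h) = comp \<Gamma> (f g) (f h)" if "g \<in> carrier G" "h \<in> carrier G" for g h
    using f that by (simp add: iso_def hom_def vertex_group_def)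
  have f_cont: "continuous_map T (arrows \<Gamma>) f"
    using homeomorphic_imp_continuous_map[OF fh]
    by (simp add: vertex_topology_def continuous_map_in_subtopology)
  define Y where "Y = subtopology X {z \<in> topspace X. \<rho> z = x}"
  have topY: "topspace Y = {z \<in> topspace X. \<rho> z = x}"
    by (auto simp: Y_def)
  have actable: "(z, f g) \<in> actable \<Gamma> X \<rho>" if "z \<in> topspace Y" "g \<in> carrier G" for z g
    using that f_in by (simp add: topY actable_def)
  have closed: "act z (f g) \<in> topspace Y" if "z \<in> topspace Y" "g \<in> carrier G" for z g
    using act_in anchor_act actable f_in that by (simp add: topY)
  have mult: "act (act z (f g)) (f h) = act z (f (g \<otimes>\<^bsub>G\<^esub> h))"
    if "z \<in> topspace Y" "g \<in> carrier G" "h \<in> carrier G" for z g h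
    using act_comp[OF actable[OF that(1,2)], of "f h"] that f_in
    by (simp add: f_mult composable_def)
  have one: "act z (f \<one>\<^bsub>G\<^esub>) = z" if "z \<in> topspace Y" for z
  proof -
    \<comment> \<open>The vertex group has not been established as a group, so the argument takes
      place in the groupoid: \<open>?e\<close> is an idempotent loop, and composing with its inverse
      on the right cancels one factor.\<close>
    have "f \<one>\<^bsub>G\<^esub> = unit \<Gamma> x"
    proof -
      let ?e = "f \<one>\<^bsub>G\<^esub>"
      have e: "?e \<in> topspace (arrows \<Gamma>)" "source \<Gamma> ?e = x" "target \<Gamma> ?e = x"
        using f_in by simp_all
      have ee: "comp \<Gamma> ?e ?e = ?e" using f_mult[of "\<one>\<^bsub>G\<^esub>" "\<one>\<^bsub>G\<^esub>"] by simp
      have "comp \<Gamma> (comp \<Gamma> ?e ?e) (inverse_arrow \<Gamma> ?e) = comp \<Gamma> ?e (comp \<Gamma> ?e (inverse_arrow \<Gamma> ?e))"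
        using e by (intro comp_assoc) (auto simp: composable_def inverse_in source_inverse)
      then show ?thesis using e ee inverse_right[of ?e] unit_right[of ?e] by simp
    qed
    then show ?thesis using act_unit that by (auto simp: topY)
  qed
  \<comment> \<open>The groupoid acts on the right and \<open>G\<close> on the left; the inverse
    reverses the order of products. The restriction makes each map extensional, as
    \<open>group_action\<close> demands.\<close>
  define \<phi> where "\<phi> g = restrict (\<lambda>z. act z (f (inv\<^bsub>G\<^esub> g))) (topspace Y)" for g
  have "continuous_action G T Y \<phi>"
    unfolding continuous_action_def
  proof
    show "group_action G (topspace Y) \<phi>"
      by (rule group_actionI)
        (use closed one mult in \<open>auto simp: \<phi>_def is_group inv_mult_group\<close>)
    have "continuous_map (prod_topology T Y) (arrows \<Gamma>) (\<lambda>p. f (inv\<^bsub>G\<^esub> (fst p)))"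
      using continuous_map_compose[OF continuous_map_compose[OF continuous_map_fst continuous_inv] f_cont]
      by (simp add: o_def)
    moreover have "continuous_map (prod_topology T Y) X snd"
      using continuous_map_snd[of T Y] by (simp add: Y_def continuous_map_in_subtopology)
    ultimately have "continuous_map (prod_topology T Y)
        (subtopology (prod_topology X (arrows \<Gamma>)) (actable \<Gamma> X \<rho>)) (\<lambda>p. (snd p, f (inv\<^bsub>G\<^esub> (fst p))))"
      using actable
      by (auto simp: continuous_map_in_subtopology continuous_map_pairwise o_def topspace_eq)
    from continuous_map_compose[OF this continuous_act]
    have "continuous_map (prod_topology T Y) X (\<lambda>p. act (snd p) (f (inv\<^bsub>G\<^esub> (fst p))))"
      by (simp add: o_def)
    moreover have "act (snd p) (f (inv\<^bsub>G\<^esub> (fst p))) \<in> topspace Y"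
      if "p \<in> topspace (prod_topology T Y)" for p
      using that closed by (auto simp: topspace_eq)
    ultimately have "continuous_map (prod_topology T Y) Y (\<lambda>p. act (snd p) (f (inv\<^bsub>G\<^esub> (fst p))))"
      unfolding Y_def continuous_map_in_subtopology by (auto simp flip: Y_def simp: topY)
    then show "continuous_map (prod_topology T Y) Y (\<lambda>(g, z). \<phi> g z)"
      by (rule continuous_map_eq) (auto simp: \<phi>_def)
  qed
  moreover have "compact_space Y" using compact by (simp add: Y_def compact_space_subtopology)
  moreover have "Hausdorff_space Y" using X by (simp add: Y_def Hausdorff_space_subtopology)
  moreover have "topspace Y \<noteq> {}" using nonempty by (auto simp: topY)
  ultimately obtain \<xi> where \<xi>: "\<xi> \<in> topspace Y" and fixed: "\<And>g. g \<in> carrier G \<Longrightarrow> \<phi> g \<xi> = \<xi>"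
    using extremely_amenable_fixed_point[OF TG ea] by metis
  have "act \<xi> h = \<xi>" if "h \<in> topspace (arrows \<Gamma>)" "source \<Gamma> h = x" "target \<Gamma> h = x" for h
  proof -
    have "h \<in> f ` carrier G" using that bij carr by simp
    then obtain g where "g \<in> carrier G" "h = f g" by blast
    \<comment> \<open>The inverse cancels the one built into \<open>\<phi>\<close>, leaving the
      action of \<open>f g = h\<close>.\<close>
    then show ?thesis using fixed[of "inv\<^bsub>G\<^esub> g"] \<xi> by (simp add: \<phi>_def)
  qed
  then show ?thesis using \<xi> by (auto simp: topY)
qed

text \<open>The fibre over the chosen object \<open>x\<close> is compact because \<open>{x}\<close>
  is. It is nonempty because transitivity provides an arrow that carries some point of
  \<open>X\<close> into it.\<close>

lemma extremely_amenable_imp_invariant_section: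
  assumes "topological_group G T" "extremely_amenable G T"
    and "topological_groupoid \<Gamma>" "locally_trivial_groupoid \<Gamma>" "transitive_groupoid \<Gamma>"
    and "has_structural_group \<Gamma> G T"
    and "Hausdorff_space X" "topspace X \<noteq> {}"
    and "groupoid_action \<Gamma> X \<rho> act" "proper_anchor \<Gamma> X \<rho>"
  shows "\<exists>\<sigma>. continuous_invariant_section \<Gamma> X \<rho> act \<sigma>"
proof -
  interpret groupoid_action \<Gamma> X \<rho> act by fact
  obtain x where x: "x \<in> topspace (objects \<Gamma>)"
    and iso: "topological_group_iso G T (vertex_group \<Gamma> x) (vertex_topology \<Gamma> x)"
    using assms unfolding has_structural_group_def by blast
  obtain z where z: "z \<in> topspace X" using assms by blast
  then have "\<rho> z \<in> topspace (objects \<Gamma>)"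
    using continuous_map_image_subset_topspace[OF continuous_anchor] by blast
  then obtain g where "g \<in> topspace (arrows \<Gamma>)" "source \<Gamma> g = \<rho> z" "target \<Gamma> g = x"
    using \<open>transitive_groupoid \<Gamma>\<close> x unfolding transitive_groupoid_def by blast
  then have "act z g \<in> topspace X" "\<rho> (act z g) = x"
    using z act_in anchor_act by (simp_all add: actable_def)
  moreover have "compactin X {z \<in> topspace X. \<rho> z = x}"
    using \<open>proper_anchor \<Gamma> X \<rho>\<close> x unfolding proper_anchor_def
    by (auto dest!: spec[of _ "{x}"])
  ultimately obtain \<xi> where "\<xi> \<in> topspace X" "\<rho> \<xi> = x"
    "\<forall>h\<in>topspace (arrows \<Gamma>). source \<Gamma> h = x \<longrightarrow> target \<Gamma> h = x \<longrightarrow> act \<xi> h = \<xi>"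
    using fibre_fixed_point[OF assms(1-3) assms(9) iso] assms by blast
  then show ?thesis
    using invariant_section_of_fixed_point assms by metis
qed

section \<open>Homeomorphic copies in a sum type\<close>

text \<open>The copy of \<open>T\<close> in the left summand. It serves to place the group and its
  test spaces in the sum types over which groupoids and spaces are quantified.\<close>

definition Inl_topology :: "'a topology \<Rightarrow> ('a + 'b) topology"
  where "Inl_topology T = pullback_topology (Inl ` topspace T) projl T"

lemma topspace_Inl_topology: "topspace (Inl_topology T) = Inl ` topspace T"
  by (auto simp: Inl_topology_def topspace_pullback_topology)

lemma continuous_map_projl: "continuous_map (Inl_topology T) T projl"
  using continuous_map_pullback[OF continuous_map_id] by (simp add: Inl_topology_def o_def)

lemma continuous_map_Inl: "continuous_map T (Inl_topology T) Inl"
  unfolding Inl_topology_def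
  by (rule continuous_map_pullback') (auto simp: o_def)

lemma homeomorphic_maps_Inl: "homeomorphic_maps T (Inl_topology T) Inl projl"
  using continuous_map_projl continuous_map_Inl
  by (auto simp: homeomorphic_maps_def topspace_Inl_topology)

lemma homeomorphic_space_Inl: "T homeomorphic_space Inl_topology T"
  using homeomorphic_maps_Inl unfolding homeomorphic_space_def by blast

section \<open>A topological group as a groupoid\<close>

text \<open>The object type is arbitrary, so \<open>undefined\<close> serves as the single object.
  All arrows have the form \<open>Inl g\<close>, hence the value of \<open>projl\<close> on the
  right summand does not matter.\<close>

definition one_object_groupoid ::
    "('g, 'm) monoid_scheme \<Rightarrow> 'g topology \<Rightarrow> ('o, 'g + 'a) groupoid"
  where "one_object_groupoid G T =
    \<lparr>objects = discrete_topology {undefined}, arrows = Inl_topology T,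
     source = (\<lambda>_. undefined), target = (\<lambda>_. undefined),
     comp = (\<lambda>g h. Inl (projl g \<otimes>\<^bsub>G\<^esub> projl h)), unit = (\<lambda>_. Inl \<one>\<^bsub>G\<^esub>),
     inverse_arrow = (\<lambda>g. Inl (inv\<^bsub>G\<^esub> (projl g)))\<rparr>"

lemma one_object_groupoid_sel [simp]:
  "objects (one_object_groupoid G T) = discrete_topology {undefined}"
  "arrows (one_object_groupoid G T) = Inl_topology T"
  "source (one_object_groupoid G T) = (\<lambda>_. undefined)"
  "target (one_object_groupoid G T) = (\<lambda>_. undefined)"
  "comp (one_object_groupoid G T) = (\<lambda>g h. Inl (projl g \<otimes>\<^bsub>G\<^esub> projl h))"
  "unit (one_object_groupoid G T) = (\<lambda>_. Inl \<one>\<^bsub>G\<^esub>)"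
  "inverse_arrow (one_object_groupoid G T) = (\<lambda>g. Inl (inv\<^bsub>G\<^esub> (projl g)))"
  by (simp_all add: one_object_groupoid_def)

context topological_group
begin

text \<open>Any two arrows are composable, and the groupoid laws become the group laws once
  \<open>Inl\<close> and \<open>projl\<close> cancel. The operations are those of \<open>G\<close>
  between the continuous maps \<open>projl\<close> and \<open>Inl\<close>.\<close>

lemma topological_groupoid_one_object:
  "topological_groupoid (one_object_groupoid G T :: ('o, 'g + 'a) groupoid)"
proof
  let ?\<Gamma> = "one_object_groupoid G T :: ('o, 'g + 'a) groupoid"
  let ?A = "Inl_topology T :: ('g + 'a) topology"
  show "Hausdorff_space (arrows ?\<Gamma>)"
    using homeomorphic_Hausdorff_space[OF homeomorphic_space_Inl] Hausdorff by auto
  have "continuous_map (prod_topology ?A ?A) (prod_topology T T) (\<lambda>(g, h). (projl g, projl h))"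
    by (simp add: continuous_map_prod_top continuous_map_projl)
  from continuous_map_compose[OF continuous_map_compose[OF this continuous_mult] continuous_map_Inl]
  have "continuous_map (prod_topology ?A ?A) ?A (\<lambda>(g, h). Inl (projl g \<otimes> projl h))"
    by (simp add: o_def case_prod_unfold)
  then show "continuous_map (subtopology (prod_topology (arrows ?\<Gamma>) (arrows ?\<Gamma>)) (composable ?\<Gamma>))
      (arrows ?\<Gamma>) (\<lambda>(g, h). comp ?\<Gamma> g h)"
    by (simp add: continuous_map_from_subtopology)
  show "continuous_map (arrows ?\<Gamma>) (arrows ?\<Gamma>) (inverse_arrow ?\<Gamma>)"
    using continuous_map_compose[OF continuous_map_compose[OF continuous_map_projl continuous_inv]
        continuous_map_Inl]
    by (simp add: o_def)
qed (auto simp: topspace_Inl_topology topspace_eq composable_def m_assoc continuous_map_const)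

text \<open>Every arrow is a loop at \<open>undefined\<close>, so the vertex group is the whole
  arrow space and \<open>Inl\<close> is the required isomorphism.\<close>

lemma one_object_groupoid_structural_group:
  "has_structural_group (one_object_groupoid G T :: ('o, 'g + 'a) groupoid) G T"
proof -
  let ?\<Gamma> = "one_object_groupoid G T :: ('o, 'g + 'a) groupoid"
  have carr: "carrier (vertex_group ?\<Gamma> undefined) = Inl ` carrier G"
    by (simp add: vertex_group_def topspace_Inl_topology topspace_eq)
  have "(Inl :: 'g \<Rightarrow> 'g + 'a) \<in> iso G (vertex_group ?\<Gamma> undefined)"
    unfolding iso_def hom_def carr by (auto simp: vertex_group_def bij_betw_def)
  moreover have "vertex_topology ?\<Gamma> undefined = Inl_topology T"
    unfolding vertex_topology_def carr
    by (metis one_object_groupoid_sel(2) subtopology_topspace topspace_Inl_topology topspace_eq)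
  ultimately show ?thesis
    using homeomorphic_maps_map[THEN iffD1, OF homeomorphic_maps_Inl]
    unfolding has_structural_group_def topological_group_iso_def by auto
qed

text \<open>The inverse turns the left action \<open>\<phi>\<close> into a right action, and over a
  single object every arrow can be applied to every point.\<close>

lemma groupoid_action_one_object:
  assumes act: "continuous_action G T X \<phi>"
  shows "groupoid_action (one_object_groupoid G T :: ('o, 'g + 'a) groupoid)
    (Inl_topology X :: ('x + 'y) topology) (\<lambda>_. undefined) (\<lambda>z g. Inl (\<phi> (inv (projl g)) (projl z)))"
proof -
  let ?A = "Inl_topology T :: ('g + 'a) topology"
  interpret A: group_action G "topspace X" \<phi>
    using act by (simp add: continuous_action_def)
  have cont: "continuous_map (prod_topology T X) X (\<lambda>(g, x). \<phi> g x)"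
    using act by (simp add: continuous_action_def)
  have one: "\<phi> \<one> x = x" if "x \<in> topspace X" for x
    using A.id_eq_one that by (metis restrict_apply')
  let ?X = "Inl_topology X :: ('x + 'y) topology"
  have "continuous_map (prod_topology ?X ?A) T (\<lambda>p. inv (projl (snd p)))"
    using continuous_map_compose[OF continuous_map_compose[OF
          continuous_map_snd[of ?X ?A] continuous_map_projl] continuous_inv]
    by (simp add: o_def)
  moreover have "continuous_map (prod_topology ?X ?A) X (\<lambda>p. projl (fst p))"
    using continuous_map_compose[OF continuous_map_fst[of ?X ?A] continuous_map_projl]
    by (simp add: o_def)
  ultimately have "continuous_map (prod_topology ?X ?A) (prod_topology T X)
      (\<lambda>p. (inv (projl (snd p)), projl (fst p)))"
    by (simp add: continuous_map_pairwise o_def)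
  from continuous_map_compose[OF continuous_map_compose[OF this cont] continuous_map_Inl]
  have "continuous_map (prod_topology ?X ?A) ?X
      (\<lambda>(z, g). Inl (\<phi> (inv (projl g)) (projl z)))"
    by (simp add: o_def case_prod_unfold)
  then show ?thesis
    by unfold_locales
      (auto simp: continuous_map_from_subtopology actable_def composable_def topspace_Inl_topology
        topspace_eq inv_mult_group A.composition_rule one)
qed

end

section \<open>From invariant sections to fixed points\<close>

text \<open>A test space for extreme amenability has points in \<open>'g set set\<close>, so its
  copy fits into the type of \<open>X\<close> in \<open>sections\<close>. A section over one object
  picks a single point, and its invariance says that the group fixes that point.\<close>

lemma invariant_section_imp_extremely_amenable:
  fixes G :: "('g, 'm) monoid_scheme" and T :: "'g topology"
  assumes "topological_group G T"
    and sections: "\<And>(\<Gamma> :: ('o, 'g + 'a) groupoid) (X :: ('g set set + 'x) topology) \<rho> act.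
       topological_groupoid \<Gamma> \<Longrightarrow> locally_trivial_groupoid \<Gamma> \<Longrightarrow> transitive_groupoid \<Gamma> \<Longrightarrow>
       has_structural_group \<Gamma> G T \<Longrightarrow> Hausdorff_space X \<Longrightarrow> topspace X \<noteq> {} \<Longrightarrow>
       groupoid_action \<Gamma> X \<rho> act \<Longrightarrow> proper_anchor \<Gamma> X \<rho> \<Longrightarrow>
       \<exists>\<sigma>. continuous_invariant_section \<Gamma> X \<rho> act \<sigma>"
  shows "extremely_amenable G T"
  unfolding extremely_amenable_def
proof (intro allI impI, elim conjE)
  interpret topological_group G T by fact
  let ?\<Gamma> = "one_object_groupoid G T :: ('o, 'g + 'a) groupoid"
  fix X :: "'g set set topology" and \<phi>
  assume X: "compact_space X" "Hausdorff_space X" "topspace X \<noteq> {}"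
    and act: "continuous_action G T X \<phi>"
  let ?X = "Inl_topology X :: ('g set set + 'x) topology"
  let ?act = "\<lambda>(z :: 'g set set + 'x) (g :: 'g + 'a). Inl (\<phi> (inv\<^bsub>G\<^esub> (projl g)) (projl z))"
  have "locally_trivial_groupoid ?\<Gamma>"
    unfolding locally_trivial_groupoid_def
    \<comment> \<open>The whole object space is trivialised by the constant unit arrow.\<close>
    by (intro ballI exI[of _ "{undefined}"] exI[of _ "\<lambda>_. Inl \<one>\<^bsub>G\<^esub>"])
      (auto simp: topspace_Inl_topology topspace_eq continuous_map_const)
  moreover have "transitive_groupoid ?\<Gamma>"
    by (auto simp: transitive_groupoid_def topspace_Inl_topology topspace_eq)
  moreover have "compact_space ?X"
    using homeomorphic_compact_space[OF homeomorphic_space_Inl] X by blast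
  \<comment> \<open>The anchor is constant, so the preimage of \<open>K\<close> is either empty or
    all of the compact space \<open>?X\<close>.\<close>
  then have "compactin ?X {z \<in> topspace ?X. undefined \<in> K}" for K :: "'o set"
    by (cases "undefined \<in> K") (simp_all add: compact_space_def)
  then have "proper_anchor ?\<Gamma> ?X (\<lambda>_. undefined)"
    by (simp add: proper_anchor_def)
  moreover have "Hausdorff_space ?X" "topspace ?X \<noteq> {}"
    using homeomorphic_Hausdorff_space[OF homeomorphic_space_Inl] X
    by (auto simp: topspace_Inl_topology)
  ultimately obtain \<sigma> where "continuous_invariant_section ?\<Gamma> ?X (\<lambda>_. undefined) ?act \<sigma>"
    using sections[OF topological_groupoid_one_object _ _ one_object_groupoid_structural_group
        _ _ groupoid_action_one_object[OF act]] by blast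
  then have cont: "continuous_map (discrete_topology {undefined}) ?X \<sigma>"
    and inv: "\<And>g. g \<in> carrier G \<Longrightarrow> ?act (\<sigma> undefined) (Inl g) = \<sigma> undefined"
    by (auto simp: continuous_invariant_section_def topspace_Inl_topology topspace_eq)
  have "\<sigma> undefined \<in> Inl ` topspace X"
    using continuous_map_image_subset_topspace[OF cont] by (simp add: topspace_Inl_topology)
  then obtain x where x: "x \<in> topspace X" "\<sigma> undefined = Inl x" by blast
  have "\<phi> g x = x" if "g \<in> carrier G" for g
    \<comment> \<open>\<open>?act\<close> contains an inverse, so invariance under the inverse of
      \<open>g\<close> is what yields \<open>\<phi> g x = x\<close>.\<close>
    using inv[of "inv\<^bsub>G\<^esub> g"] that x by simp
  with x show "\<exists>x\<in>topspace X. \<forall>g\<in>carrier G. \<phi> g x = x" by blast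
qed

theorem theorem7:
  fixes G :: "('g, 'm) monoid_scheme" and T :: "'g topology"
  assumes "topological_group G T"
  shows "extremely_amenable G T \<longleftrightarrow>
    (\<forall>(\<Gamma> :: ('o, 'g + 'a) groupoid) (X :: ('g set set + 'x) topology) \<rho> act.
       topological_groupoid \<Gamma> \<and> locally_trivial_groupoid \<Gamma> \<and> transitive_groupoid \<Gamma> \<and>
       has_structural_group \<Gamma> G T \<and>
       Hausdorff_space X \<and> topspace X \<noteq> {} \<and>
       groupoid_action \<Gamma> X \<rho> act \<and> proper_anchor \<Gamma> X \<rho>
       \<longrightarrow> (\<exists>\<sigma>. continuous_invariant_section \<Gamma> X \<rho> act \<sigma>))"
proof
  assume "extremely_amenable G T"
  with assms show "\<forall>(\<Gamma> :: ('o, 'g + 'a) groupoid) (X :: ('g set set + 'x) topology) \<rho> act.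
       topological_groupoid \<Gamma> \<and> locally_trivial_groupoid \<Gamma> \<and> transitive_groupoid \<Gamma> \<and>
       has_structural_group \<Gamma> G T \<and>
       Hausdorff_space X \<and> topspace X \<noteq> {} \<and>
       groupoid_action \<Gamma> X \<rho> act \<and> proper_anchor \<Gamma> X \<rho>
       \<longrightarrow> (\<exists>\<sigma>. continuous_invariant_section \<Gamma> X \<rho> act \<sigma>)"
    by (intro allI impI, elim conjE) (rule extremely_amenable_imp_invariant_section)
next
  assume "\<forall>(\<Gamma> :: ('o, 'g + 'a) groupoid) (X :: ('g set set + 'x) topology) \<rho> act.
       topological_groupoid \<Gamma> \<and> locally_trivial_groupoid \<Gamma> \<and> transitive_groupoid \<Gamma> \<and>
       has_structural_group \<Gamma> G T \<and>
       Hausdorff_space X \<and> topspace X \<noteq> {} \<and>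
       groupoid_action \<Gamma> X \<rho> act \<and> proper_anchor \<Gamma> X \<rho>
       \<longrightarrow> (\<exists>\<sigma>. continuous_invariant_section \<Gamma> X \<rho> act \<sigma>)"
  with assms show "extremely_amenable G T"
    by (intro invariant_section_imp_extremely_amenable) blast+
qed

end
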